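(* Let $T_1>0$, $T_0\in[0,T_1)$, $\alpha\in(\tfrac12,1)$, $\beta\in(0,\alpha)$, and let $x:[0,T_1]\to\mathbb R^d$ be Lipschitz. For $i=1,2$ let $f^{(i)}:\Lambda^\alpha_\beta([0,T_1],\mathbb R^m)\to L(\mathbb R^d,\mathbb R^m)$ be continuous non-anticipative functionals such that (i) for every compact $K\subset\mathcal C^\alpha_\beta([0,T_1],\mathbb R^m)$ there is $L_K>0$ with $|f^{(i)}(t,u_{\cdot\wedge t})-f^{(i)}(t,v_{\cdot\wedge t})|\le L_K(|u_0-v_0|+\|u_{\cdot\wedge t}-v_{\cdot\wedge t}\|_{\beta;[0,T_1]})$ for all $t\in[0,T_1]$, $u,v\in K$; (ii) there is $C>0$ with $|f^{(i)}(t,u_{\cdot\wedge t})|\le C(1+|u_0|+\|u_{\cdot\wedge t}\|_{\beta;[0,T_1]})$ for all $(t,u_{\cdot\wedge t})\in\Lambda^\alpha_\beta([0,T_1],\mathbb R^m)$. Let $(T_0,w^{(1)}_{\cdot\wedge T_0}),(T_0,w^{(2)}_{\cdot\wedge T_0})\in\Lambda^\alpha_\beta([0,T_1],\mathbb R^m)$ and, for $i=1,2$, let $y^{(i)}$ be the global solution of $$y^{(i)}_t=w^{(i)}_t\ (t\in[0,T_0]),\qquad y^{(i)}_t=w^{(i)}_{T_0}+\int_{T_0}^tf^{(i)}(s,y^{(i)}_{\cdot\wedge s})\,\mathrm dx_s\ (t\in[T_0,T_1]).$$ Then there exists a compact set $\mathcal K\subset[0,T_1]\times\mathcal C^\alpha_\beta([0,T_1],\mathbb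 R^m)$ containing the trajectories of $y^{(1)}$ and $y^{(2)}$ and a constant $C_{\mathcal K,x}>0$ depending on $\mathcal K$ and $x$ such that $$\|y^{(1)}-y^{(2)}\|_{\beta;[0,T_1]}\le C_{\mathcal K,x}\Big(|w^{(1)}_0-w^{(2)}_0|+\|w^{(1)}-w^{(2)}\|_{\beta;[0,T_0]}+\|(f^{(1)}-f^{(2)})|_{\mathcal K/\sim}\|_\infty\Big).$$ In particular, if $w^{(1)}|_{[0,T_0]}=w^{(2)}|_{[0,T_0]}$, then $$\|y^{(1)}-y^{(2)}\|_{\beta;[T_0,T_1]}\le 2^N\Big(1+\frac1{L_{\mathcal K}}\Big)\|(f^{(1)}-f^{(2)})|_{\mathcal K/\sim}\|_\infty,\qquad N=\Big\lceil T_1\big(2L_{\mathcal K}\|x\|_{1;[0,T_1]}\big)^{1/(1-\beta)}\Big\rceil,$$ where $L_{\mathcal K}>0$ is a constant depending on $\mathcal K$.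
   Context: For $\gamma\in(0,1]$, $\mathcal C^\gamma([0,T],\mathbb R^m)$ denotes the space of $\gamma$-H\"older continuous paths, with seminorm $\|y\|_{\gamma;[a,b]}=\sup_{a\le s<t\le b}|y_t-y_s|/|t-s|^\gamma$ and norm $|y_0|+\|y\|_{\gamma;[0,T]}$ ($\gamma=1$ means Lipschitz). For $\beta<\alpha$, $\mathcal C^\alpha_\beta([0,T],\mathbb R^m)$ is the set $\mathcal C^\alpha([0,T],\mathbb R^m)$ with the topology of the norm $|y_0|+\|y\|_{\beta;[0,T]}$. $y_{\cdot\wedge t}$ is the path stopped at $t$. $\Lambda^\alpha_\beta([0,T],\mathbb R^m)=\{(t,y_{\cdot\wedge t}):t\in[0,T],\ y\in\mathcal C^\alpha([0,T],\mathbb R^m)\}$ has metric $|t-s|+|y_0-z_0|+\|y_{\cdot\wedge t}-z_{\cdot\wedge s}\|_{\beta;[0,T]}$. A non-anticipative functional is a map on $\Lambda^\alpha_\beta$. For $\mathcal K\subset[0,T]\times\mathcal C^\alpha_\beta$, $\mathcal K/\sim$ denotes $\{(t,y_{\cdot\wedge t}):(t,y)\in\mathcal K\}\subset\Lambda^\alpha_\beta$, and $\|g|_{\mathcal K/\sim}\|_\infty$ is the supremum of $|g|$ over it. "$\mathcal K$ contains the trajectory of $y$" means $(t,y)\in\mathcal K$ for the relevant times $t\in[T_0,T_1]$ (so $(t,y_{\cdot\wedge t})\in\mathcal K/\sim$). Under (i)–(ii) each equation has a unique solution on $[0,T_1]$, which is $\alpha$-H\"older. Integrals are Riemann–Stieltjes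 integrals, $\int f\,\mathrm dx=\sum_j\int f^j\,\mathrm dx^j$. Dependence of constants on $\mathcal K$ includes dependence, through the Lipschitz constants of the functionals on compacts as in (i), on the functionals, and dependence on the fixed parameters $T_1,\beta$. *)

theory Defs
  imports "HOL-Analysis.Analysis"
begin

section \<open>Hoelder spaces\<close>

text \<open>
  The conventions for degenerate cases are that the seminorm is 0 if \<open>b \<le> a\<close> (where the supremum
  is over the empty set) and if \<open>y\<close> is not \<open>\<gamma>\<close>-Hoelder on \<open>[a,b]\<close>. The latter makes
  the distances below nonnegative on arbitrary functions, as \<open>Metric_space\<close> demands; on Hoelder
  paths of exponent at least \<open>\<gamma>\<close> it never applies.
\<close>

definition holder_quotients :: "real \<Rightarrow> real \<Rightarrow> real \<Rightarrow> (real \<Rightarrow> 'a::real_normed_vector) \<Rightarrow> real set" where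
  "holder_quotients \<gamma> a b y =
     {norm (y t - y s) / (t - s) powr \<gamma> | s t. a \<le> s \<and> s < t \<and> t \<le> b}"

definition holder_seminorm :: "real \<Rightarrow> real \<Rightarrow> real \<Rightarrow> (real \<Rightarrow> 'a::real_normed_vector) \<Rightarrow> real" where
  "holder_seminorm \<gamma> a b y =
     (if bdd_above (holder_quotients \<gamma> a b y) then Sup (insert 0 (holder_quotients \<gamma> a b y)) else 0)"

text \<open>Paths on \<open>[0,T]\<close> are extensional functions, so that equality in HOL is equality on \<open>[0,T]\<close>.\<close>

definition holder_paths :: "real \<Rightarrow> real \<Rightarrow> (real \<Rightarrow> 'a::real_normed_vector) set" where
  "holder_paths \<gamma> T =
     {y \<in> extensional {0..T}.
        \<exists>C. \<forall>s\<in>{0..T}. \<forall>t\<in>{0..T}. norm (y t - y s) \<le> C * \<bar>t - s\<bar> powr \<gamma>}"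

definition holder_dist :: "real \<Rightarrow> real \<Rightarrow> (real \<Rightarrow> 'a::real_normed_vector) \<Rightarrow> (real \<Rightarrow> 'a) \<Rightarrow> real" where
  "holder_dist \<beta> T y z = norm (y 0 - z 0) + holder_seminorm \<beta> 0 T (\<lambda>s. y s - z s)"

definition holder_topology :: "real \<Rightarrow> real \<Rightarrow> real \<Rightarrow> (real \<Rightarrow> 'a::real_normed_vector) topology" where
  "holder_topology \<alpha> \<beta> T = Metric_space.mtopology (holder_paths \<alpha> T) (holder_dist \<beta> T)"

lemma holder_quotients_bounded:
  assumes "\<beta> \<le> \<alpha>" "y \<in> holder_paths \<alpha> T" "z \<in> holder_paths \<alpha> T"
  shows "bdd_above (holder_quotients \<beta> 0 T (\<lambda>s. y s - z s))"
proof -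
  obtain C where C: "\<And>s t. s \<in> {0..T} \<Longrightarrow> t \<in> {0..T} \<Longrightarrow> norm (y t - y s) \<le> C * \<bar>t - s\<bar> powr \<alpha>"
    using assms(2) unfolding holder_paths_def by blast
  obtain D where D: "\<And>s t. s \<in> {0..T} \<Longrightarrow> t \<in> {0..T} \<Longrightarrow> norm (z t - z s) \<le> D * \<bar>t - s\<bar> powr \<alpha>"
    using assms(3) unfolding holder_paths_def by blast
  have "norm ((y t - z t) - (y s - z s)) / (t - s) powr \<beta> \<le> (\<bar>C\<bar> + \<bar>D\<bar>) * T powr (\<alpha> - \<beta>)"
    if st: "0 \<le> s" "s < t" "t \<le> T" for s t
  proof -
    have "norm ((y t - z t) - (y s - z s)) = norm ((y t - y s) - (z t - z s))"
      by (simp add: algebra_simps)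
    also have "\<dots> \<le> norm (y t - y s) + norm (z t - z s)"
      by (rule norm_triangle_ineq4)
    also have "\<dots> \<le> C * (t - s) powr \<alpha> + D * (t - s) powr \<alpha>"
      using C[of s t] D[of s t] st by (intro add_mono) auto
    also have "\<dots> \<le> (\<bar>C\<bar> + \<bar>D\<bar>) * (t - s) powr \<alpha>"
      by (simp add: distrib_right add_mono mult_right_mono)
    also have "(t - s) powr \<alpha> = (t - s) powr (\<alpha> - \<beta>) * (t - s) powr \<beta>"
      by (simp flip: powr_add)
    finally have "norm ((y t - z t) - (y s - z s)) / (t - s) powr \<beta>
        \<le> (\<bar>C\<bar> + \<bar>D\<bar>) * (t - s) powr (\<alpha> - \<beta>)"
      using st by (simp add: pos_divide_le_eq mult.assoc)
    also have "\<dots> \<le> (\<bar>C\<bar> + \<bar>D\<bar>) * T powr (\<alpha> - \<beta>)"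
      using st assms(1) by (intro mult_left_mono powr_mono2) auto
    finally show ?thesis .
  qed
  then show ?thesis
    unfolding holder_quotients_def
    by (intro bdd_aboveI[where M = "(\<bar>C\<bar> + \<bar>D\<bar>) * T powr (\<alpha> - \<beta>)"]) blast
qed

lemma holder_seminorm_nonneg: "0 \<le> holder_seminorm \<gamma> a b y"
  by (auto simp: holder_seminorm_def intro!: cSup_upper)

lemma holder_dist_nonneg: "0 \<le> holder_dist \<beta> T y z"
  by (simp add: holder_dist_def holder_seminorm_nonneg)

lemma holder_dist_commute: "holder_dist \<beta> T y z = holder_dist \<beta> T z y"
proof -
  have "norm ((y t - z t) - (y s - z s)) = norm ((z t - y t) - (z s - y s))" for s t
    using norm_minus_commute[of "y t - z t" "y s - z s"] by (simp add: algebra_simps)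
  then show ?thesis
    by (simp add: holder_dist_def holder_seminorm_def holder_quotients_def norm_minus_commute)
qed

lemma Metric_space_holder:
  assumes "0 \<le> T" "\<beta> \<le> \<alpha>"
  shows "Metric_space (holder_paths \<alpha> T) (holder_dist \<beta> T)"
proof
  let ?n = "\<lambda>y z. holder_seminorm \<beta> 0 T (\<lambda>s. y s - z s)"
  have le: "norm ((y t - z t) - (y s - z s)) / (t - s) powr \<beta> \<le> ?n y z"
    if "y \<in> holder_paths \<alpha> T" "z \<in> holder_paths \<alpha> T" "0 \<le> s" "s < t" "t \<le> T"
    for y z :: "real \<Rightarrow> 'a" and s t
  proof -
    have "norm ((y t - z t) - (y s - z s)) / (t - s) powr \<beta> \<in> holder_quotients \<beta> 0 T (\<lambda>s. y s - z s)"
      using that unfolding holder_quotients_def by blast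
    then show ?thesis
      using holder_quotients_bounded[OF assms(2) that(1,2)]
      by (auto simp: holder_seminorm_def intro!: cSup_upper)
  qed
  show "holder_dist \<beta> T y z = 0 \<longleftrightarrow> y = z"
    if yz: "y \<in> holder_paths \<alpha> T" "z \<in> holder_paths \<alpha> T" for y z :: "real \<Rightarrow> 'a"
  proof
    assume "holder_dist \<beta> T y z = 0"
    then have 0: "y 0 = z 0" "?n y z = 0"
      using holder_seminorm_nonneg[of \<beta> 0 T "\<lambda>s. y s - z s"]
      by (simp_all add: holder_dist_def add_nonneg_eq_0_iff)
    have "y t = z t" if "t \<in> {0..T}" for t
    proof (cases "t = 0")
      case False
      then have "norm ((y t - z t) - (y 0 - z 0)) / (t - 0) powr \<beta> \<le> 0"
        using le[of y z 0 t] yz that 0 by auto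
      then show ?thesis
        using False that 0 by (auto simp: divide_le_0_iff)
    qed (use 0 in auto)
    then show "y = z"
      using yz by (intro extensionalityI[of y "{0..T}" z]) (auto simp: holder_paths_def)
  next
    assume "y = z"
    moreover have "holder_seminorm \<beta> 0 T (\<lambda>s. 0 :: 'a) = 0"
    proof -
      have "insert 0 (holder_quotients \<beta> 0 T (\<lambda>s. 0 :: 'a)) = {0}"
        by (auto simp: holder_quotients_def)
      then have "Sup (insert 0 (holder_quotients \<beta> 0 T (\<lambda>s. 0 :: 'a))) = 0"
        by (simp only: cSup_singleton)
      then show ?thesis by (simp add: holder_seminorm_def)
    qed
    ultimately show "holder_dist \<beta> T y z = 0"
      by (simp add: holder_dist_def)
  qed
  show "holder_dist \<beta> T u w \<le> holder_dist \<beta> T u v + holder_dist \<beta> T v w"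
    if uvw: "u \<in> holder_paths \<alpha> T" "v \<in> holder_paths \<alpha> T" "w \<in> holder_paths \<alpha> T"
    for u v w :: "real \<Rightarrow> 'a"
  proof -
    have "q \<le> ?n u v + ?n v w" if "q \<in> insert 0 (holder_quotients \<beta> 0 T (\<lambda>s. u s - w s))" for q
    proof (cases "q = 0")
      case True
      then show ?thesis by (simp add: holder_seminorm_nonneg)
    next
      case False
      then obtain s t where st: "0 \<le> s" "s < t" "t \<le> T"
        and q: "q = norm ((u t - w t) - (u s - w s)) / (t - s) powr \<beta>"
        using \<open>q \<in> insert 0 (holder_quotients _ _ _ _)\<close> unfolding holder_quotients_def by blast
      have "norm ((u t - w t) - (u s - w s)) =
          norm (((u t - v t) - (u s - v s)) + ((v t - w t) - (v s - w s)))"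
        by (simp add: algebra_simps)
      also have "\<dots> \<le> norm ((u t - v t) - (u s - v s)) + norm ((v t - w t) - (v s - w s))"
        by (rule norm_triangle_ineq)
      finally have "q \<le> norm ((u t - v t) - (u s - v s)) / (t - s) powr \<beta>
          + norm ((v t - w t) - (v s - w s)) / (t - s) powr \<beta>"
        unfolding q add_divide_distrib[symmetric] by (rule divide_right_mono) simp
      also have "\<dots> \<le> ?n u v + ?n v w"
        using le st uvw by (intro add_mono) auto
      finally show ?thesis .
    qed
    then have "Sup (insert 0 (holder_quotients \<beta> 0 T (\<lambda>s. u s - w s))) \<le> ?n u v + ?n v w"
      by (intro cSup_least) auto
    then have "?n u w \<le> ?n u v + ?n v w"
      using holder_quotients_bounded[OF assms(2) uvw(1,3)] by (simp add: holder_seminorm_def)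
    moreover have "norm (u 0 - w 0) \<le> norm (u 0 - v 0) + norm (v 0 - w 0)"
      using norm_triangle_ineq[of "u 0 - v 0" "v 0 - w 0"] by simp
    ultimately show ?thesis by (simp add: holder_dist_def)
  qed
qed (simp_all add: holder_dist_nonneg holder_dist_commute)

section \<open>Stopped paths\<close>

definition stop :: "real \<Rightarrow> real \<Rightarrow> (real \<Rightarrow> 'a) \<Rightarrow> real \<Rightarrow> 'a" where
  "stop T t y = (\<lambda>s\<in>{0..T}. y (min s t))"

definition stopped_paths :: "real \<Rightarrow> real \<Rightarrow> (real \<times> (real \<Rightarrow> 'a::real_normed_vector)) set" where
  "stopped_paths \<alpha> T = {(t, stop T t y) | t y. t \<in> {0..T} \<and> y \<in> holder_paths \<alpha> T}"

definition stopped_dist ::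
    "real \<Rightarrow> real \<Rightarrow> real \<times> (real \<Rightarrow> 'a::real_normed_vector) \<Rightarrow> real \<times> (real \<Rightarrow> 'a) \<Rightarrow> real" where
  "stopped_dist \<beta> T = (\<lambda>(t, y) (s, z). \<bar>t - s\<bar> + holder_dist \<beta> T y z)"

definition stopped_topology ::
    "real \<Rightarrow> real \<Rightarrow> real \<Rightarrow> (real \<times> (real \<Rightarrow> 'a::real_normed_vector)) topology" where
  "stopped_topology \<alpha> \<beta> T = Metric_space.mtopology (stopped_paths \<alpha> T) (stopped_dist \<beta> T)"

lemma stop_in_holder_paths:
  assumes "0 \<le> \<alpha>" "t \<in> {0..T}" "y \<in> holder_paths \<alpha> T"
  shows "stop T t y \<in> holder_paths \<alpha> T"
proof -
  obtain C where C: "\<And>r s. r \<in> {0..T} \<Longrightarrow> s \<in> {0..T} \<Longrightarrow> norm (y s - y r) \<le> C * \<bar>s - r\<bar> powr \<alpha>"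
    using assms(3) unfolding holder_paths_def by blast
  have "norm (stop T t y s - stop T t y r) \<le> \<bar>C\<bar> * \<bar>s - r\<bar> powr \<alpha>"
    if rs: "r \<in> {0..T}" "s \<in> {0..T}" for r s
  proof -
    have "norm (stop T t y s - stop T t y r) \<le> C * \<bar>min s t - min r t\<bar> powr \<alpha>"
      using C[of "min r t" "min s t"] rs assms(2) by (auto simp: stop_def)
    also have "\<dots> \<le> \<bar>C\<bar> * \<bar>s - r\<bar> powr \<alpha>"
      using assms(1) by (intro mult_mono powr_mono2) auto
    finally show ?thesis .
  qed
  moreover have "stop T t y \<in> extensional {0..T}"
    by (simp add: stop_def)
  ultimately show ?thesis unfolding holder_paths_def by blast
qed

lemma Metric_space_stopped:
  assumes "0 \<le> T" "\<beta> \<le> \<alpha>" "0 \<le> \<alpha>"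
  shows "Metric_space (stopped_paths \<alpha> T) (stopped_dist \<beta> T)"
proof -
  interpret P: Metric_space "holder_paths \<alpha> T :: (real \<Rightarrow> 'a) set" "holder_dist \<beta> T"
    by (rule Metric_space_holder[OF assms(1,2)])
  have "stopped_paths \<alpha> T \<subseteq> UNIV \<times> (holder_paths \<alpha> T :: (real \<Rightarrow> 'a) set)"
    using stop_in_holder_paths[OF assms(3)] by (auto simp: stopped_paths_def)
  then have sub: "p \<in> stopped_paths \<alpha> T \<Longrightarrow> snd p \<in> holder_paths \<alpha> T" for p :: "real \<times> (real \<Rightarrow> 'a)"
    by auto
  show ?thesis
  proof
    fix p q r :: "real \<times> (real \<Rightarrow> 'a)"
    show "0 \<le> stopped_dist \<beta> T p q"
      by (simp add: stopped_dist_def case_prod_beta)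
    show "stopped_dist \<beta> T p q = stopped_dist \<beta> T q p"
      by (simp add: stopped_dist_def case_prod_beta P.commute abs_minus_commute)
    show "stopped_dist \<beta> T p q = 0 \<longleftrightarrow> p = q"
      if "p \<in> stopped_paths \<alpha> T" "q \<in> stopped_paths \<alpha> T"
      using P.zero[OF sub sub, OF that]
      by (auto simp: stopped_dist_def case_prod_beta add_nonneg_eq_0_iff prod_eq_iff)
    show "stopped_dist \<beta> T p r \<le> stopped_dist \<beta> T p q + stopped_dist \<beta> T q r"
      if "p \<in> stopped_paths \<alpha> T" "q \<in> stopped_paths \<alpha> T" "r \<in> stopped_paths \<alpha> T"
      using P.triangle[OF sub sub sub, OF that]
      by (auto simp: stopped_dist_def case_prod_beta)
  qed
qed

text \<open>The set written \<open>K / \<sim>\<close>.\<close>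

definition stop_image :: "real \<Rightarrow> (real \<times> (real \<Rightarrow> 'a)) set \<Rightarrow> (real \<times> (real \<Rightarrow> 'a)) set" where
  "stop_image T K = (\<lambda>(t, y). (t, stop T t y)) ` K"


section \<open>Non-anticipative functionals\<close>

text \<open>
  A functional is a HOL function on all pairs, of which only the values on \<open>stopped_paths \<alpha> T\<close>
  are ever used. \<open>L K\<close> is the Lipschitz constant on the compact set \<open>K\<close>.
\<close>

definition lipschitz_on_compacts ::
    "real \<Rightarrow> real \<Rightarrow> real \<Rightarrow> (real \<times> (real \<Rightarrow> 'a::real_normed_vector) \<Rightarrow> 'b::real_normed_vector)
      \<Rightarrow> ((real \<Rightarrow> 'a) set \<Rightarrow> real) \<Rightarrow> bool" where
  "lipschitz_on_compacts \<alpha> \<beta> T f L \<longleftrightarrow>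
     (\<forall>K. compactin (holder_topology \<alpha> \<beta> T) K \<longrightarrow>
        L K > 0 \<and>
        (\<forall>t\<in>{0..T}. \<forall>u\<in>K. \<forall>v\<in>K.
           norm (f (t, stop T t u) - f (t, stop T t v)) \<le>
             L K * (norm (u 0 - v 0) +
                    holder_seminorm \<beta> 0 T (\<lambda>s. stop T t u s - stop T t v s))))"

definition linear_growth ::
    "real \<Rightarrow> real \<Rightarrow> real \<Rightarrow> (real \<times> (real \<Rightarrow> 'a::real_normed_vector) \<Rightarrow> 'b::real_normed_vector) \<Rightarrow> bool" where
  "linear_growth \<alpha> \<beta> T f \<longleftrightarrow>
     (\<exists>C>0. \<forall>(t, u)\<in>stopped_paths \<alpha> T.
        norm (f (t, u)) \<le> C * (1 + norm (u 0) + holder_seminorm \<beta> 0 T u))"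


section \<open>Riemann--Stieltjes integrals and the path-dependent equation\<close>

text \<open>
  A tagged division subordinate to balls of radius \<open>\<delta>\<close> has mesh less than \<open>2 * \<delta>\<close>, and every
  tagged division of mesh less than \<open>\<delta>\<close> is subordinate to them: this is the limit of
  Riemann--Stieltjes sums as the mesh tends to 0.
\<close>

definition has_rs_integral ::
    "(real \<Rightarrow> 'a::real_normed_vector) \<Rightarrow> (real \<Rightarrow> real) \<Rightarrow> 'a \<Rightarrow> real \<Rightarrow> real \<Rightarrow> bool" where
  "has_rs_integral g x I a b \<longleftrightarrow>
     (\<forall>e>0. \<exists>\<delta>>0. \<forall>p. p tagged_division_of {a..b} \<and> (\<lambda>s. ball s \<delta>) fine p \<longrightarrow>
        norm ((\<Sum>(s, k)\<in>p. (x (Sup k) - x (Inf k)) *\<^sub>R g s) - I) < e)"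

text \<open>The column \<open>f\<^sup>j\<close> of \<open>f\<close> is its value at the \<open>j\<close>-th standard basis vector.\<close>

definition has_vector_rs_integral ::
    "(real \<Rightarrow> (real^'d) \<Rightarrow>\<^sub>L 'a::real_normed_vector) \<Rightarrow> (real \<Rightarrow> real^'d) \<Rightarrow> 'a \<Rightarrow> real \<Rightarrow> real \<Rightarrow> bool" where
  "has_vector_rs_integral f x I a b \<longleftrightarrow>
     (\<exists>J :: 'd \<Rightarrow> 'a.
        (\<forall>j. has_rs_integral (\<lambda>s. blinfun_apply (f s) (axis j 1)) (\<lambda>s. x s $ j) (J j) a b) \<and>
        I = (\<Sum>j\<in>UNIV. J j))"

definition is_solution ::
    "real \<Rightarrow> real \<Rightarrow> real \<Rightarrow> (real \<Rightarrow> real^'d)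
      \<Rightarrow> (real \<times> (real \<Rightarrow> 'a::real_normed_vector) \<Rightarrow> (real^'d) \<Rightarrow>\<^sub>L 'a)
      \<Rightarrow> (real \<Rightarrow> 'a) \<Rightarrow> (real \<Rightarrow> 'a) \<Rightarrow> bool" where
  "is_solution \<alpha> T\<^sub>0 T x f w y \<longleftrightarrow>
     y \<in> holder_paths \<alpha> T \<and>
     (\<forall>t\<in>{0..T\<^sub>0}. y t = w t) \<and>
     (\<forall>t\<in>{T\<^sub>0..T}. \<exists>I.
        has_vector_rs_integral (\<lambda>s. f (s, stop T s y)) x I T\<^sub>0 t \<and> y t = w T\<^sub>0 + I)"

end

theory Submission
  imports Defs
begin

text \<open>
  The difference \<open>y1 - y2\<close> solves a linear Stieltjes inequality: on an interval \<open>[a,b]\<close> its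
  \<open>\<beta>\<close>-seminorm is at most \<open>X (b - a)\<^sup>1\<^sup>-\<^sup>\<beta> (L (D + A b) + \<epsilon>)\<close>, where \<open>X\<close> is the Lipschitz constant of
  \<open>x\<close>, \<open>D\<close> the distance of the initial values, \<open>A b\<close> the seminorm on \<open>[0,b]\<close> and \<open>\<epsilon>\<close> the distance
  of the functionals. If \<open>b - a\<close> is so small that \<open>L X (b - a)\<^sup>1\<^sup>-\<^sup>\<beta> \<le> 1/2\<close>, the term \<open>A b\<close> is absorbed on
  the left, and \<open>A + D + \<epsilon> / L\<close> at most doubles from \<open>a\<close> to \<open>b\<close>. The factor \<open>2 ^ N\<close> comes from \<open>N\<close> such steps.
  Only Lipschitz continuity along the two solutions enters, so the compact set \<open>[0,T] \<times> {y1, y2}\<close> is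
  large enough.
\<close>

section \<open>Hoelder seminorms\<close>

text \<open>The condition \<open>0 \<le> B\<close> covers the inserted 0, hence the empty supremum
  for \<open>b \<le> a\<close>.\<close>

lemma holder_seminorm_le:
  assumes "0 \<le> B" "\<And>s t. \<lbrakk>a \<le> s; s < t; t \<le> b\<rbrakk> \<Longrightarrow> norm (y t - y s) \<le> B * (t - s) powr \<gamma>"
  shows "holder_seminorm \<gamma> a b y \<le> B"
proof -
  have "q \<le> B" if "q \<in> insert 0 (holder_quotients \<gamma> a b y)" for q
    using that assms by (auto simp: holder_quotients_def pos_divide_le_eq)
  then have "Sup (insert 0 (holder_quotients \<gamma> a b y)) \<le> B"
    by (intro cSup_least) auto
  then show ?thesis
    using assms(1) by (simp add: holder_seminorm_def)
qed

text \<open>Boundedness of the quotients matters here: without it the seminorm has its default value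
  0 and the bound fails. The case \<open>s = t\<close> is allowed because both sides are then
  0.\<close>

lemma norm_diff_le_holder_seminorm:
  assumes "bdd_above (holder_quotients \<gamma> a b y)" "a \<le> s" "s \<le> t" "t \<le> b"
  shows "norm (y t - y s) \<le> holder_seminorm \<gamma> a b y * (t - s) powr \<gamma>"
proof (cases "s = t")
  case False
  have "norm (y t - y s) / (t - s) powr \<gamma> \<in> holder_quotients \<gamma> a b y"
    using assms False unfolding holder_quotients_def by force
  then have "norm (y t - y s) / (t - s) powr \<gamma> \<le> holder_seminorm \<gamma> a b y"
    using assms(1) by (auto simp: holder_seminorm_def intro!: cSup_upper)
  then show ?thesis
    using assms False by (simp add: pos_divide_le_eq)
qed simp

lemma bdd_above_holder_quotients_subinterval:
  assumes "bdd_above (holder_quotients \<gamma> a b y)" "a \<le> c" "d \<le> b"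
  shows "bdd_above (holder_quotients \<gamma> c d y)"
  using assms(1) by (rule bdd_above_mono) (use assms(2,3) in \<open>force simp: holder_quotients_def\<close>)

lemma holder_seminorm_subinterval:
  assumes "bdd_above (holder_quotients \<gamma> a b y)" "a \<le> c" "d \<le> b"
  shows "holder_seminorm \<gamma> c d y \<le> holder_seminorm \<gamma> a b y"
proof (rule holder_seminorm_le[OF holder_seminorm_nonneg])
  fix s t assume "c \<le> s" "s < t" "t \<le> d"
  then show "norm (y t - y s) \<le> holder_seminorm \<gamma> a b y * (t - s) powr \<gamma>"
    using assms(2,3) by (intro norm_diff_le_holder_seminorm[OF assms(1)]) auto
qed

lemma holder_quotients_cong:
  assumes "\<And>s. \<lbrakk>a \<le> s; s \<le> b\<rbrakk> \<Longrightarrow> y s = z s"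
  shows "holder_quotients \<gamma> a b y = holder_quotients \<gamma> a b z"
proof -
  have "norm (y t - y s) = norm (z t - z s)" if "a \<le> s" "s < t" "t \<le> b" for s t
    using assms[of s] assms[of t] that by simp
  then show ?thesis
    unfolding holder_quotients_def by (intro Collect_cong) metis
qed

lemma holder_seminorm_cong:
  assumes "\<And>s. \<lbrakk>a \<le> s; s \<le> b\<rbrakk> \<Longrightarrow> y s = z s"
  shows "holder_seminorm \<gamma> a b y = holder_seminorm \<gamma> a b z"
proof -
  have "holder_quotients \<gamma> a b y = holder_quotients \<gamma> a b z"
    using assms by (rule holder_quotients_cong)
  then show ?thesis by (simp add: holder_seminorm_def)
qed

text \<open>The known bound concerns differences of two paths, so the zero path, made extensional,
  is taken as the second one.\<close>

lemma bdd_above_holder_quotients_path: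
  assumes "\<beta> \<le> \<alpha>" "y \<in> holder_paths \<alpha> T"
  shows "bdd_above (holder_quotients \<beta> 0 T y)"
proof -
  have "(\<lambda>s\<in>{0..T}. 0) \<in> holder_paths \<alpha> T"
    unfolding holder_paths_def by (auto intro!: exI[of _ 0])
  from holder_quotients_bounded[OF assms this] show ?thesis
    using holder_quotients_cong[of 0 T y "\<lambda>s. y s - (\<lambda>s\<in>{0..T}. 0) s" \<beta>] by simp
qed

text \<open>Only an increment across \<open>b\<close> needs an argument: it is split at
  \<open>b\<close>, and since \<open>\<gamma>\<close> is nonnegative both pieces have a length whose
  power is at most that of the whole.\<close>

lemma holder_seminorm_concat:
  assumes "0 \<le> \<gamma>" "bdd_above (holder_quotients \<gamma> a c y)" "a \<le> b" "b \<le> c"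
  shows "holder_seminorm \<gamma> a c y \<le> holder_seminorm \<gamma> a b y + holder_seminorm \<gamma> b c y"
proof (rule holder_seminorm_le)
  let ?l = "holder_seminorm \<gamma> a b y" and ?r = "holder_seminorm \<gamma> b c y"
  show "0 \<le> ?l + ?r"
    by (simp add: holder_seminorm_nonneg)
  have left: "norm (y t - y s) \<le> ?l * (t - s) powr \<gamma>" if "a \<le> s" "s \<le> t" "t \<le> b" for s t
    using bdd_above_holder_quotients_subinterval[OF assms(2) order_refl assms(4)] that
    by (rule norm_diff_le_holder_seminorm)
  have right: "norm (y t - y s) \<le> ?r * (t - s) powr \<gamma>" if "b \<le> s" "s \<le> t" "t \<le> c" for s t
    using bdd_above_holder_quotients_subinterval[OF assms(2) assms(3) order_refl] that
    by (rule norm_diff_le_holder_seminorm)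
  fix s t assume st: "a \<le> s" "s < t" "t \<le> c"
  have nonneg: "0 \<le> ?l * (t - s) powr \<gamma>" "0 \<le> ?r * (t - s) powr \<gamma>"
    by (simp_all add: holder_seminorm_nonneg)
  consider "t \<le> b" | "b \<le> s" | "s < b" "b < t" by linarith
  then show "norm (y t - y s) \<le> (?l + ?r) * (t - s) powr \<gamma>"
  proof cases
    case 1
    then show ?thesis using left[of s t] st nonneg by (simp add: distrib_right)
  next
    case 2
    then show ?thesis using right[of s t] st nonneg by (simp add: distrib_right)
  next
    case 3
    have "norm (y t - y s) \<le> norm (y b - y s) + norm (y t - y b)"
      using norm_triangle_ineq[of "y b - y s" "y t - y b"] by simp
    also have "\<dots> \<le> ?l * (b - s) powr \<gamma> + ?r * (t - b) powr \<gamma>"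
      using left[of s b] right[of b t] st 3 by (intro add_mono) auto
    also have "\<dots> \<le> ?l * (t - s) powr \<gamma> + ?r * (t - s) powr \<gamma>"
      using 3 assms(1) by (intro add_mono mult_left_mono powr_mono2 holder_seminorm_nonneg) auto
    finally show ?thesis by (simp add: distrib_right)
  qed
qed

text \<open>Stopping composes the path with \<open>min _ t\<close>, which does not increase
  distances. The path \<open>z\<close> is left general so that it can be a stopped path or a
  difference of two stopped paths.\<close>

lemma holder_seminorm_stopped_le:
  assumes "0 \<le> \<gamma>" "bdd_above (holder_quotients \<gamma> 0 t y)" "0 \<le> t"
    and z: "\<And>s. \<lbrakk>0 \<le> s; s \<le> T\<rbrakk> \<Longrightarrow> z s = y (min s t)"
  shows "holder_seminorm \<gamma> 0 T z \<le> holder_seminorm \<gamma> 0 t y"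
proof (rule holder_seminorm_le[OF holder_seminorm_nonneg])
  fix r s assume rs: "0 \<le> r" "r < s" "s \<le> T"
  have "norm (z s - z r) = norm (y (min s t) - y (min r t))"
    using z rs by simp
  also have "\<dots> \<le> holder_seminorm \<gamma> 0 t y * (min s t - min r t) powr \<gamma>"
    using rs assms(2,3) by (intro norm_diff_le_holder_seminorm) auto
  also have "\<dots> \<le> holder_seminorm \<gamma> 0 t y * (s - r) powr \<gamma>"
    using rs assms(1) by (intro mult_left_mono powr_mono2 holder_seminorm_nonneg) auto
  finally show "norm (z s - z r) \<le> holder_seminorm \<gamma> 0 t y * (s - r) powr \<gamma>" .
qed

section \<open>Riemann--Stieltjes integrals\<close>

lemma has_rs_integral_diff:
  assumes "has_rs_integral g x I a b" "has_rs_integral h x J a b"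
  shows "has_rs_integral (\<lambda>s. g s - h s) x (I - J) a b"
  unfolding has_rs_integral_def
proof (intro allI impI)
  fix e :: real assume "0 < e"
  then have e: "0 < e / 2" by simp
  obtain \<delta> where \<delta>: "0 < \<delta>" "\<And>p. \<lbrakk>p tagged_division_of {a..b}; (\<lambda>s. ball s \<delta>) fine p\<rbrakk> \<Longrightarrow>
        norm ((\<Sum>(s, k)\<in>p. (x (Sup k) - x (Inf k)) *\<^sub>R g s) - I) < e / 2"
    using assms(1)[unfolded has_rs_integral_def, rule_format, OF e] by auto
  obtain \<eta> where \<eta>: "0 < \<eta>" "\<And>p. \<lbrakk>p tagged_division_of {a..b}; (\<lambda>s. ball s \<eta>) fine p\<rbrakk> \<Longrightarrow>
        norm ((\<Sum>(s, k)\<in>p. (x (Sup k) - x (Inf k)) *\<^sub>R h s) - J) < e / 2"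
    using assms(2)[unfolded has_rs_integral_def, rule_format, OF e] by auto
  show "\<exists>\<delta>>0. \<forall>p. p tagged_division_of {a..b} \<and> (\<lambda>s. ball s \<delta>) fine p \<longrightarrow>
      norm ((\<Sum>(s, k)\<in>p. (x (Sup k) - x (Inf k)) *\<^sub>R (g s - h s)) - (I - J)) < e"
  proof (intro exI conjI allI impI)
    show "0 < min \<delta> \<eta>" using \<delta>(1) \<eta>(1) by simp
    fix p assume p: "p tagged_division_of {a..b} \<and> (\<lambda>s. ball s (min \<delta> \<eta>)) fine p"
    then have fine: "(\<lambda>s. ball s \<delta>) fine p" "(\<lambda>s. ball s \<eta>) fine p"
      by (force simp: fine_def)+
    let ?S = "\<lambda>g. \<Sum>(s, k)\<in>p. (x (Sup k) - x (Inf k)) *\<^sub>R g s"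
    have S: "?S (\<lambda>s. g s - h s) = ?S g - ?S h"
      by (simp add: case_prod_beta scaleR_diff_right sum_subtractf)
    have "norm (?S (\<lambda>s. g s - h s) - (I - J)) = norm ((?S g - I) - (?S h - J))"
      unfolding S by (simp add: algebra_simps)
    also have "\<dots> < e"
      using norm_triangle_ineq4[of "?S g - I" "?S h - J"]
        \<delta>(2)[OF conjunct1[OF p] fine(1)] \<eta>(2)[OF conjunct1[OF p] fine(2)] by linarith
    finally show "norm (?S (\<lambda>s. g s - h s) - (I - J)) < e" .
  qed
qed

lemma has_vector_rs_integral_diff:
  assumes "has_vector_rs_integral f x I a b" "has_vector_rs_integral g x J a b"
  shows "has_vector_rs_integral (\<lambda>s. f s - g s) x (I - J) a b"
proof -
  obtain U where U: "\<And>j. has_rs_integral (\<lambda>s. blinfun_apply (f s) (axis j 1)) (\<lambda>s. x s $ j) (U j) a b"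
    and I: "I = (\<Sum>j\<in>UNIV. U j)"
    using assms(1) unfolding has_vector_rs_integral_def by blast
  obtain V where V: "\<And>j. has_rs_integral (\<lambda>s. blinfun_apply (g s) (axis j 1)) (\<lambda>s. x s $ j) (V j) a b"
    and J: "J = (\<Sum>j\<in>UNIV. V j)"
    using assms(2) unfolding has_vector_rs_integral_def by blast
  have "has_rs_integral (\<lambda>s. blinfun_apply (f s - g s) (axis j 1)) (\<lambda>s. x s $ j) (U j - V j) a b" for j
    using has_rs_integral_diff[OF U[of j] V[of j]] by (simp add: minus_blinfun.rep_eq)
  then show ?thesis
    unfolding has_vector_rs_integral_def I J
    by (intro exI[of _ "\<lambda>j. U j - V j"]) (simp add: sum_subtractf)
qed

lemma blinfun_apply_axis_expansion:
  fixes F :: "(real^'d) \<Rightarrow>\<^sub>L 'a::real_normed_vector"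
  shows "blinfun_apply F v = (\<Sum>j\<in>UNIV. (v $ j) *\<^sub>R blinfun_apply F (axis j 1))"
proof -
  have "blinfun_apply F v = blinfun_apply F (\<Sum>j\<in>UNIV. (v $ j) *\<^sub>R axis j 1)"
    using basis_expansion[of v] by (simp add: scalar_mult_eq_scaleR)
  then show ?thesis
    by (simp add: blinfun.sum_right blinfun.scaleR_right)
qed

text \<open>The columns are assembled into sums in which \<open>f s\<close> acts on the whole
  increment of \<open>x\<close>. Operator norms then apply directly, and no factor depending on the
  dimension enters later estimates. Each column gets an equal share of \<open>e\<close>, and the
  least of the finitely many mesh bounds serves all of them.\<close>

lemma has_vector_rs_integral_sums:
  fixes f :: "real \<Rightarrow> (real^'d) \<Rightarrow>\<^sub>L 'a::real_normed_vector"
  assumes "has_vector_rs_integral f x I a b" "0 < e"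
  obtains \<delta> where "0 < \<delta>"
    "\<And>p. \<lbrakk>p tagged_division_of {a..b}; (\<lambda>s. ball s \<delta>) fine p\<rbrakk> \<Longrightarrow>
      norm ((\<Sum>(s, k)\<in>p. blinfun_apply (f s) (x (Sup k) - x (Inf k))) - I) < e"
proof -
  obtain U where U: "\<And>j. has_rs_integral (\<lambda>s. blinfun_apply (f s) (axis j 1)) (\<lambda>s. x s $ j) (U j) a b"
    and I: "I = (\<Sum>j\<in>UNIV. U j)"
    using assms(1) unfolding has_vector_rs_integral_def by blast
  let ?S = "\<lambda>p j. \<Sum>(s, k)\<in>p. (x (Sup k) $ j - x (Inf k) $ j) *\<^sub>R blinfun_apply (f s) (axis j 1)"
  define e' where "e' = e / real CARD('d)"
  have "0 < e'" using assms(2) by (simp add: e'_def zero_less_card_finite)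
  then have "\<forall>j. \<exists>\<delta>>0. \<forall>p. p tagged_division_of {a..b} \<and> (\<lambda>s. ball s \<delta>) fine p \<longrightarrow>
      norm (?S p j - U j) < e'"
    using U unfolding has_rs_integral_def by blast
  from choice[OF this] obtain \<delta> where \<delta>: "\<And>j. 0 < \<delta> j"
    "\<And>j p. \<lbrakk>p tagged_division_of {a..b}; (\<lambda>s. ball s (\<delta> j)) fine p\<rbrakk> \<Longrightarrow> norm (?S p j - U j) < e'"
    by blast
  show thesis
  proof (rule that)
    show "0 < Min (range \<delta>)" using \<delta>(1) by simp
    fix p assume p: "p tagged_division_of {a..b}" "(\<lambda>s. ball s (Min (range \<delta>))) fine p"
    have fine: "(\<lambda>s. ball s (\<delta> j)) fine p" for j
    proof -
      have "ball s (Min (range \<delta>)) \<subseteq> ball s (\<delta> j)" for s by (intro subset_ball) simp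
      then show ?thesis using p(2) unfolding fine_def by blast
    qed
    have "(\<Sum>(s, k)\<in>p. blinfun_apply (f s) (x (Sup k) - x (Inf k))) = (\<Sum>j\<in>UNIV. ?S p j)"
      by (subst blinfun_apply_axis_expansion, subst sum.swap) (simp add: case_prod_beta)
    then have "norm ((\<Sum>(s, k)\<in>p. blinfun_apply (f s) (x (Sup k) - x (Inf k))) - I)
        = norm (\<Sum>j\<in>UNIV. ?S p j - U j)"
      by (simp add: I sum_subtractf)
    also have "\<dots> \<le> (\<Sum>j\<in>UNIV. norm (?S p j - U j))"
      by (rule norm_sum)
    also have "\<dots> < (\<Sum>j\<in>(UNIV :: 'd set). e')"
      using \<delta>(2)[OF p(1) fine] by (intro sum_strict_mono) auto
    also have "\<dots> = e" by (simp add: e'_def)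
    finally show "norm ((\<Sum>(s, k)\<in>p. blinfun_apply (f s) (x (Sup k) - x (Inf k))) - I) < e" .
  qed
qed

text \<open>Each term is at most \<open>M * X\<close> times the length of its interval, and these
  lengths add up to \<open>t - s\<close>. They are written as \<open>measure lborel k\<close> so
  that additivity of content over a tagged division applies.\<close>

lemma norm_rs_sum_le:
  assumes q: "q tagged_division_of {s..t}" and "s \<le> t" "0 \<le> X"
    and x: "\<And>u v. \<lbrakk>s \<le> u; u \<le> v; v \<le> t\<rbrakk> \<Longrightarrow> norm (x v - x u) \<le> X * (v - u)"
    and M: "\<And>r. \<lbrakk>s \<le> r; r \<le> t\<rbrakk> \<Longrightarrow> norm (f r) \<le> M"
  shows "norm (\<Sum>(r, k)\<in>q. blinfun_apply (f r) (x (Sup k) - x (Inf k))) \<le> M * X * (t - s)"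
proof -
  have "norm (\<Sum>(r, k)\<in>q. blinfun_apply (f r) (x (Sup k) - x (Inf k)))
      \<le> (\<Sum>(r, k)\<in>q. M * X * measure lborel k)"
  proof (rule sum_norm_le, clarify)
    fix r k assume rk: "(r, k) \<in> q"
    obtain u v where k: "k = {u..v}"
      using tagged_division_ofD(4)[OF q rk] by auto
    have r: "r \<in> k" "k \<subseteq> {s..t}"
      using tagged_division_ofD(2,3)[OF q rk] by auto
    then have uv: "s \<le> u" "u \<le> v" "v \<le> t" "s \<le> r" "r \<le> t"
      by (auto simp: k)
    have "norm (blinfun_apply (f r) (x v - x u)) \<le> norm (f r) * norm (x v - x u)"
      by (rule norm_blinfun)
    also have "\<dots> \<le> M * (X * (v - u))"
      using uv order_trans[OF norm_ge_zero M] by (intro mult_mono x M) auto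
    finally show "norm (blinfun_apply (f r) (x (Sup k) - x (Inf k))) \<le> M * X * measure lborel k"
      using uv by (simp add: k mult.assoc)
  qed
  also have "\<dots> = M * X * (t - s)"
    using additive_content_tagged_division[of q s t] q \<open>s \<le> t\<close>
    by (simp add: case_prod_beta flip: sum_distrib_left)
  finally show ?thesis .
qed

text \<open>The equation provides integrals with the fixed lower limit \<open>a\<close>, so an
  increment has to be estimated through additivity. This is done on the level of sums: a fine
  division of \<open>{a..s}\<close> is extended by a fine division of \<open>{s..t}\<close>, and
  only the added part contributes \<open>M * X * (t - s)\<close>.\<close>

lemma norm_rs_increment_le:
  fixes f :: "real \<Rightarrow> (real^'d) \<Rightarrow>\<^sub>L 'a::real_normed_vector"
  assumes I: "has_vector_rs_integral f x I a s" and J: "has_vector_rs_integral f x J a t"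
    and le: "a \<le> s" "s \<le> t" "0 \<le> X"
    and x: "\<And>u v. \<lbrakk>s \<le> u; u \<le> v; v \<le> t\<rbrakk> \<Longrightarrow> norm (x v - x u) \<le> X * (v - u)"
    and M: "\<And>r. \<lbrakk>s \<le> r; r \<le> t\<rbrakk> \<Longrightarrow> norm (f r) \<le> M"
  shows "norm (J - I) \<le> M * X * (t - s)"
proof (rule field_le_epsilon)
  fix e :: real assume "0 < e"
  then have e: "0 < e / 2" by simp
  let ?g = "\<lambda>(r, k). blinfun_apply (f r) (x (Sup k) - x (Inf k))"
  obtain \<delta> where \<delta>: "0 < \<delta>"
    "\<And>p. \<lbrakk>p tagged_division_of {a..s}; (\<lambda>r. ball r \<delta>) fine p\<rbrakk> \<Longrightarrow> norm (sum ?g p - I) < e / 2"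
    using has_vector_rs_integral_sums[OF I e] by blast
  obtain \<eta> where \<eta>: "0 < \<eta>"
    "\<And>p. \<lbrakk>p tagged_division_of {a..t}; (\<lambda>r. ball r \<eta>) fine p\<rbrakk> \<Longrightarrow> norm (sum ?g p - J) < e / 2"
    using has_vector_rs_integral_sums[OF J e] by blast
  have gauge: "gauge (\<lambda>r :: real. ball r (min \<delta> \<eta>))"
    using \<delta>(1) \<eta>(1) by (simp add: gauge_def)
  obtain p where p: "p tagged_division_of {a..s}" "(\<lambda>r. ball r (min \<delta> \<eta>)) fine p"
    using fine_division_exists_real[OF gauge] by blast
  obtain q where q: "q tagged_division_of {s..t}" "(\<lambda>r. ball r (min \<delta> \<eta>)) fine q"
    using fine_division_exists_real[OF gauge] by blast
  have pq: "(p \<union> q) tagged_division_of {a..t}"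
  proof -
    have "{a..s} \<union> {s..t} = {a..t}" using le by auto
    then show ?thesis
      using tagged_division_Un[OF p(1) q(1)] le by (auto simp: interior_atLeastAtMost_real)
  qed
  have fine: "(\<lambda>r. ball r \<delta>) fine p" "(\<lambda>r. ball r \<eta>) fine (p \<union> q)"
    using p(2) q(2) by (force simp: fine_def)+
  \<comment> \<open>The two divisions may share the degenerate interval \<open>{s}\<close>. Its term
    vanishes because the increment of \<open>x\<close> over it is 0, so the sum over the union still
    splits.\<close>
  have "?g rk = 0" if "rk \<in> p \<inter> q" for rk
  proof -
    obtain r k where "rk = (r, k)" by (cases rk)
    with that have rk: "rk = (r, k)" "(r, k) \<in> p" "(r, k) \<in> q" by auto
    have "r \<in> k" "k \<subseteq> {a..s}" "k \<subseteq> {s..t}"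
      using tagged_division_ofD(2,3)[OF p(1) rk(2)] tagged_division_ofD(3)[OF q(1) rk(3)] by auto
    then have "k = {s}" by force
    then show ?thesis by (simp add: rk(1))
  qed
  then have "sum ?g (p \<union> q) = sum ?g p + sum ?g q"
    using tagged_division_ofD(1)[OF p(1)] tagged_division_ofD(1)[OF q(1)]
    by (intro sum.union_inter_neutral) auto
  then have "J - I = sum ?g q - (sum ?g (p \<union> q) - J) + (sum ?g p - I)"
    by simp
  also have "norm \<dots> \<le> norm (sum ?g q) + norm (sum ?g (p \<union> q) - J) + norm (sum ?g p - I)"
    by (meson norm_triangle_mono norm_triangle_ineq4 order_refl)
  also have "\<dots> \<le> M * X * (t - s) + e / 2 + e / 2"
    using norm_rs_sum_le[OF q(1) le(2,3) x M] \<delta>(2)[OF p(1) fine(1)] \<eta>(2)[OF pq fine(2)]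
    by (intro add_mono) auto
  finally show "norm (J - I) \<le> M * X * (t - s) + e" by simp
qed

section \<open>Iteration over short intervals\<close>

text \<open>This is a discrete Gronwall argument for an implicit inequality, in which
  \<open>A b\<close> also occurs on the right. The quantity that at most doubles per step is
  \<open>A + D + \<epsilon> / L\<close>.\<close>

lemma absorbed_doubling:
  fixes A :: "real \<Rightarrow> real"
  assumes step: "\<And>a b. \<lbrakk>T0 \<le> a; a \<le> b; b \<le> T1\<rbrakk> \<Longrightarrow>
      A b \<le> A a + X * (b - a) powr \<kappa> * (L * (D + A b) + \<epsilon>)"
    and pos: "0 < L" "0 \<le> X" "0 \<le> D" "0 \<le> \<epsilon>" "0 < \<kappa>" "0 \<le> T0" "T0 < T1"
    and A: "\<And>b. 0 \<le> A b"
    and N: "N = nat \<lceil>T1 * (2 * L * X) powr (1 / \<kappa>)\<rceil>"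
  shows "A T1 + D + \<epsilon> / L \<le> 2 ^ N * (A T0 + D + \<epsilon> / L)"
proof (cases "X = 0")
  \<comment> \<open>Here \<open>N = 0\<close>, so no step length can be formed. A single application
    of \<open>step\<close> on the whole interval shows that \<open>A\<close> does not grow.\<close>
  case True
  then have "N = 0" by (simp add: N)
  then show ?thesis using step[of T0 T1] True pos by simp
next
  case False
  let ?c = "(2 * L * X) powr (1 / \<kappa>)"
  have c: "0 < ?c" using False pos by simp
  have N_ge: "T1 * ?c \<le> real N" unfolding N by (rule real_nat_ceiling_ge)
  moreover have "0 < T1 * ?c" using c pos by simp
  ultimately have "0 < real N" by linarith
  define h where "h = (T1 - T0) / real N"
  have h: "0 \<le> h" using pos by (simp add: h_def)
  \<comment> \<open>The constant \<open>?c\<close> is chosen such that its power with exponent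
    \<open>\<kappa>\<close> is \<open>2 * L * X\<close>; raising this inequality to that power gives
    the smallness condition \<open>half\<close>.\<close>
  have "h * ?c \<le> 1"
  proof -
    have "(T1 - T0) * ?c \<le> T1 * ?c" using c pos by (intro mult_right_mono) auto
    then show ?thesis using N_ge \<open>0 < real N\<close> by (simp add: h_def field_simps)
  qed
  then have "(h * ?c) powr \<kappa> \<le> 1 powr \<kappa>"
    using h c pos by (intro powr_mono2) auto
  then have half: "h powr \<kappa> * (2 * L * X) \<le> 1"
    using h c pos by (simp add: powr_mult powr_powr)
  have "A (T0 + real n * h) + D + \<epsilon> / L \<le> 2 ^ n * (A T0 + D + \<epsilon> / L)" if "n \<le> N" for n
    using that
  proof (induction n)
    case (Suc n)
    let ?a = "T0 + real n * h" and ?b = "T0 + real (Suc n) * h"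
    have "real (Suc n) * h \<le> real N * h"
      using Suc.prems h by (intro mult_right_mono) auto
    also have "\<dots> = T1 - T0" using \<open>0 < real N\<close> by (simp add: h_def)
    finally have "?b \<le> T1" by simp
    then have "A ?b \<le> A ?a + X * (?b - ?a) powr \<kappa> * (L * (D + A ?b) + \<epsilon>)"
      using h pos by (intro step) (auto intro!: mult_right_mono)
    moreover have "?b - ?a = h" by (simp add: algebra_simps)
    ultimately have "A ?b \<le> A ?a + X * h powr \<kappa> * (L * (D + A ?b) + \<epsilon>)" by metis
    \<comment> \<open>With \<open>2 * L\<close> factored out, the right-hand side contains half of
      the doubling quantity at \<open>?b\<close>. By \<open>half\<close> the coefficient of
      \<open>A ?b\<close> is then at most 1/2, so it can be absorbed on the left.\<close>
    moreover have "X * h powr \<kappa> * (L * (D + A ?b) + \<epsilon>)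
        = (h powr \<kappa> * (2 * L * X)) * ((D + A ?b + \<epsilon> / L) / 2)"
      using pos by (simp add: field_simps)
    also have "\<dots> \<le> 1 * ((D + A ?b + \<epsilon> / L) / 2)"
      using half A[of ?b] pos by (intro mult_right_mono) auto
    ultimately have "A ?b + D + \<epsilon> / L \<le> 2 * (A ?a + D + \<epsilon> / L)" by argo
    also have "\<dots> \<le> 2 * (2 ^ n * (A T0 + D + \<epsilon> / L))"
      using Suc by (intro mult_left_mono) auto
    finally show ?case by simp
  qed simp
  from this[of N] show ?thesis
    using \<open>0 < real N\<close> by (simp add: h_def)
qed

section \<open>The stability estimate\<close>

text \<open>Stopping keeps the initial value and does not increase the seminorm, so the growth bound
  of the full path serves all times. This makes the supremum of the difference of the functionals in
  the theorem a genuine upper bound.\<close>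

lemma linear_growth_stopped_bounded:
  assumes "linear_growth \<alpha> \<beta> T f" "0 \<le> \<beta>" "\<beta> \<le> \<alpha>" "y \<in> holder_paths \<alpha> T"
  shows "\<exists>B. \<forall>t\<in>{0..T}. norm (f (t, stop T t y)) \<le> B"
proof -
  obtain C where C: "0 < C" "\<And>t u. (t, u) \<in> stopped_paths \<alpha> T \<Longrightarrow>
      norm (f (t, u)) \<le> C * (1 + norm (u 0) + holder_seminorm \<beta> 0 T u)"
    using assms(1) unfolding linear_growth_def by blast
  have bdd: "bdd_above (holder_quotients \<beta> 0 T y)"
    using assms(3,4) by (rule bdd_above_holder_quotients_path)
  show ?thesis
  proof (intro exI ballI)
    fix t assume t: "t \<in> {0..T}"
    have "holder_seminorm \<beta> 0 T (stop T t y) \<le> holder_seminorm \<beta> 0 t y"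
      using assms(2) bdd_above_holder_quotients_subinterval[OF bdd] t
      by (intro holder_seminorm_stopped_le) (auto simp: stop_def)
    also have "\<dots> \<le> holder_seminorm \<beta> 0 T y"
      using t by (intro holder_seminorm_subinterval bdd) auto
    finally have "C * (1 + norm (stop T t y 0) + holder_seminorm \<beta> 0 T (stop T t y))
        \<le> C * (1 + norm (y 0) + holder_seminorm \<beta> 0 T y)"
      using C(1) t by (auto simp: stop_def)
    moreover have "(t, stop T t y) \<in> stopped_paths \<alpha> T"
      using t assms(4) unfolding stopped_paths_def by blast
    ultimately show "norm (f (t, stop T t y)) \<le> C * (1 + norm (y 0) + holder_seminorm \<beta> 0 T y)"
      using C(2) by fastforce
  qed
qed

text \<open>The intermediate value is \<open>f\<close> at the stopped \<open>v\<close>: the first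
  difference is Lipschitz in the paths, the second compares the functionals at one point. Stopping
  localises the seminorm to \<open>{0..t}\<close>, which is what lets the estimate be iterated in
  time.\<close>

lemma norm_coefficient_difference_le:
  assumes "0 \<le> \<beta>" "0 \<le> L" "t \<in> {0..T}"
    and lip: "norm (f (t, stop T t u) - f (t, stop T t v)) \<le>
        L * (norm (u 0 - v 0) + holder_seminorm \<beta> 0 T (\<lambda>s. stop T t u s - stop T t v s))"
    and bdd: "bdd_above (holder_quotients \<beta> 0 T (\<lambda>s. u s - v s))"
    and near: "norm (f (t, stop T t v) - g (t, stop T t v)) \<le> \<epsilon>"
  shows "norm (f (t, stop T t u) - g (t, stop T t v)) \<le>
      L * (norm (u 0 - v 0) + holder_seminorm \<beta> 0 t (\<lambda>s. u s - v s)) + \<epsilon>"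
proof -
  have "holder_seminorm \<beta> 0 T (\<lambda>s. stop T t u s - stop T t v s)
      \<le> holder_seminorm \<beta> 0 t (\<lambda>s. u s - v s)"
    using assms(1,3) bdd_above_holder_quotients_subinterval[OF bdd]
    by (intro holder_seminorm_stopped_le) (auto simp: stop_def)
  then have "norm (f (t, stop T t u) - f (t, stop T t v)) \<le>
      L * (norm (u 0 - v 0) + holder_seminorm \<beta> 0 t (\<lambda>s. u s - v s))"
    using assms(2) by (intro order_trans[OF lip] mult_left_mono) auto
  then show ?thesis
    using near norm_triangle_ineq[of "f (t, stop T t u) - f (t, stop T t v)"
        "f (t, stop T t v) - g (t, stop T t v)"] by simp
qed

text \<open>Up to time \<open>b\<close> the coefficients differ by at most \<open>M\<close>, so
  increments on \<open>{a..b}\<close> are at most \<open>M * X * (t - s)\<close>. Splitting off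
  \<open>(t - s) powr \<beta>\<close> leaves a power of the length that is at most
  \<open>(b - a) powr (1 - \<beta>)\<close>. Concatenation with \<open>{0..a}\<close> gives the
  claim.\<close>

lemma solution_difference_step:
  assumes sol: "is_solution \<alpha> T0 T x f u y" "is_solution \<alpha> T0 T x g v z"
    and par: "0 \<le> \<beta>" "\<beta> < 1" "\<beta> \<le> \<alpha>" "0 \<le> L" "0 \<le> \<epsilon>"
    and ab: "0 \<le> T0" "T0 \<le> a" "a \<le> b" "b \<le> T"
    and x: "x \<in> holder_paths 1 T"
    and lip: "\<And>t. t \<in> {0..T} \<Longrightarrow> norm (f (t, stop T t y) - f (t, stop T t z)) \<le>
        L * (norm (y 0 - z 0) + holder_seminorm \<beta> 0 T (\<lambda>s. stop T t y s - stop T t z s))"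
    and near: "\<And>t. t \<in> {0..T} \<Longrightarrow> norm (f (t, stop T t z) - g (t, stop T t z)) \<le> \<epsilon>"
  defines "A \<equiv> \<lambda>t. holder_seminorm \<beta> 0 t (\<lambda>s. y s - z s)"
  shows "A b \<le> A a + holder_seminorm 1 0 T x * (b - a) powr (1 - \<beta>) *
      (L * (norm (y 0 - z 0) + A b) + \<epsilon>)"
proof -
  define X where "X = holder_seminorm 1 0 T x"
  define M where "M = L * (norm (y 0 - z 0) + A b) + \<epsilon>"
  have X: "0 \<le> X" "\<And>s t. \<lbrakk>0 \<le> s; s \<le> t; t \<le> T\<rbrakk> \<Longrightarrow> norm (x t - x s) \<le> X * (t - s)"
    using norm_diff_le_holder_seminorm[OF bdd_above_holder_quotients_path[OF order_refl x]]
    by (auto simp: X_def holder_seminorm_nonneg)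
  have paths: "y \<in> holder_paths \<alpha> T" "z \<in> holder_paths \<alpha> T"
    using sol by (auto simp: is_solution_def)
  have bdd: "bdd_above (holder_quotients \<beta> 0 T (\<lambda>s. y s - z s))"
    using par(3) paths by (rule holder_quotients_bounded)
  have bdd_b: "bdd_above (holder_quotients \<beta> 0 b (\<lambda>s. y s - z s))"
    using bdd_above_holder_quotients_subinterval[OF bdd] ab by simp
  have "0 \<le> M"
    unfolding M_def A_def using par by (intro add_nonneg_nonneg mult_nonneg_nonneg) (auto intro: holder_seminorm_nonneg)
  let ?F = "\<lambda>s. f (s, stop T s y) - g (s, stop T s z)"
  have F: "norm (?F r) \<le> M" if "0 \<le> r" "r \<le> b" for r
  proof -
    have "A r \<le> A b"
      unfolding A_def using that by (intro holder_seminorm_subinterval bdd_b) auto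
    then have "L * (norm (y 0 - z 0) + A r) + \<epsilon> \<le> M"
      unfolding M_def using par by (intro add_mono mult_left_mono) auto
    then show ?thesis
      using norm_coefficient_difference_le[of \<beta> L r T f y z g \<epsilon>] lip[of r] near[of r] bdd par that ab
      unfolding A_def by fastforce
  qed
  \<comment> \<open>The offset \<open>u T0 - v T0\<close> does not depend on \<open>t\<close>, so it
    cancels in increments of \<open>y - z\<close>.\<close>
  have integral: "\<exists>I. has_vector_rs_integral ?F x I T0 t \<and> y t - z t = (u T0 - v T0) + I"
    if t: "t \<in> {T0..T}" for t
  proof -
    obtain I where "has_vector_rs_integral (\<lambda>s. f (s, stop T s y)) x I T0 t" "y t = u T0 + I"
      using sol(1) t unfolding is_solution_def by blast
    moreover obtain J where "has_vector_rs_integral (\<lambda>s. g (s, stop T s z)) x J T0 t" "z t = v T0 + J"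
      using sol(2) t unfolding is_solution_def by blast
    ultimately show ?thesis
      using has_vector_rs_integral_diff by (intro exI[of _ "I - J"]) auto
  qed
  have "holder_seminorm \<beta> a b (\<lambda>s. y s - z s) \<le> X * (b - a) powr (1 - \<beta>) * M"
  proof (rule holder_seminorm_le)
    show "0 \<le> X * (b - a) powr (1 - \<beta>) * M" using X(1) \<open>0 \<le> M\<close> by simp
    fix s t assume st: "a \<le> s" "s < t" "t \<le> b"
    obtain I where I: "has_vector_rs_integral ?F x I T0 s" "y s - z s = (u T0 - v T0) + I"
      using integral[of s] st ab by auto
    obtain J where J: "has_vector_rs_integral ?F x J T0 t" "y t - z t = (u T0 - v T0) + J"
      using integral[of t] st ab by auto
    have "norm ((y t - z t) - (y s - z s)) = norm (J - I)"
      using I(2) J(2) by simp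
    also have "\<dots> \<le> M * X * (t - s)"
      using st ab X F by (intro norm_rs_increment_le[OF I(1) J(1)]) auto
    also have "t - s = (t - s) powr (1 - \<beta>) * (t - s) powr \<beta>"
      using st by (simp flip: powr_add)
    also have "M * X * \<dots> \<le> M * X * ((b - a) powr (1 - \<beta>) * (t - s) powr \<beta>)"
      using st par X(1) \<open>0 \<le> M\<close>
      by (intro mult_left_mono mult_right_mono powr_mono2 mult_nonneg_nonneg) auto
    finally show "norm ((y t - z t) - (y s - z s))
        \<le> X * (b - a) powr (1 - \<beta>) * M * (t - s) powr \<beta>"
      by (simp add: mult_ac)
  qed
  moreover have "A b \<le> A a + holder_seminorm \<beta> a b (\<lambda>s. y s - z s)"
    unfolding A_def using par ab bdd_b by (intro holder_seminorm_concat) auto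
  ultimately show ?thesis by (simp add: X_def M_def)
qed

lemma solution_difference_bound:
  assumes sol: "is_solution \<alpha> T0 T x f u y" "is_solution \<alpha> T0 T x g v z"
    and par: "0 \<le> \<beta>" "\<beta> < 1" "\<beta> \<le> \<alpha>" "0 < L" "0 \<le> \<epsilon>" "0 \<le> T0" "T0 < T"
    and x: "x \<in> holder_paths 1 T"
    and lip: "\<And>t. t \<in> {0..T} \<Longrightarrow> norm (f (t, stop T t y) - f (t, stop T t z)) \<le>
        L * (norm (y 0 - z 0) + holder_seminorm \<beta> 0 T (\<lambda>s. stop T t y s - stop T t z s))"
    and near: "\<And>t. t \<in> {0..T} \<Longrightarrow> norm (f (t, stop T t z) - g (t, stop T t z)) \<le> \<epsilon>"
  shows "holder_seminorm \<beta> 0 T (\<lambda>t. y t - z t) \<le>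
      2 ^ nat \<lceil>T * (2 * L * holder_seminorm 1 0 T x) powr (1 / (1 - \<beta>))\<rceil> * (1 + 1 / L) *
      (norm (u 0 - v 0) + holder_seminorm \<beta> 0 T0 (\<lambda>t. u t - v t) + \<epsilon>)"
proof -
  define A where "A t = holder_seminorm \<beta> 0 t (\<lambda>s. y s - z s)" for t
  define D where "D = norm (y 0 - z 0)"
  define N where "N = nat \<lceil>T * (2 * L * holder_seminorm 1 0 T x) powr (1 / (1 - \<beta>))\<rceil>"
  have nonneg: "0 \<le> D" "\<And>t. 0 \<le> A t"
    by (simp_all add: D_def A_def holder_seminorm_nonneg)
  have "A T + D + \<epsilon> / L \<le> 2 ^ N * (A T0 + D + \<epsilon> / L)"
  proof (rule absorbed_doubling[OF _ par(4) _ nonneg(1) par(5) _ par(6,7) nonneg(2) N_def])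
    fix a b assume "T0 \<le> a" "a \<le> b" "b \<le> T"
    then show "A b \<le> A a + holder_seminorm 1 0 T x * (b - a) powr (1 - \<beta>) * (L * (D + A b) + \<epsilon>)"
      unfolding A_def D_def using par x lip near
      by (intro solution_difference_step[OF sol]) auto
  qed (use par in \<open>auto simp: holder_seminorm_nonneg\<close>)
  \<comment> \<open>The weights 1, 1 and \<open>1 / L\<close> are all replaced by
    \<open>1 + 1 / L\<close>, which dominates each of them.\<close>
  also have "\<dots> \<le> 2 ^ N * ((1 + 1 / L) * (D + A T0 + \<epsilon>))"
    using par nonneg(1) nonneg(2)[of T0] by (intro mult_left_mono) (auto simp: field_simps)
  finally have "A T \<le> 2 ^ N * (1 + 1 / L) * (D + A T0 + \<epsilon>)"
    using par nonneg(1) by (simp add: mult.assoc)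
      (smt (verit) divide_nonneg_pos)
  \<comment> \<open>The iteration started at \<open>T0\<close>, and up to that time the solutions
    are the prescribed initial paths.\<close>
  moreover have init: "y t = u t" "z t = v t" if "t \<in> {0..T0}" for t
    using sol that by (auto simp: is_solution_def)
  then have "A T0 = holder_seminorm \<beta> 0 T0 (\<lambda>t. u t - v t)" "D = norm (u 0 - v 0)"
    using par unfolding A_def D_def by (auto intro: holder_seminorm_cong)
  ultimately show ?thesis
    by (simp add: A_def N_def)
qed

text \<open>The functions \<open>LK\<close> and \<open>CK\<close> are chosen before the driving
  path, the functionals and the initial data. This order of quantifiers expresses that the constants
  depend only on the compact set, on \<open>x\<close> in the case of \<open>CK\<close>, and on the
  fixed \<open>T\<^sub>1\<close>, \<open>\<beta>\<close>, \<open>L1\<close> and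
  \<open>L2\<close>.\<close>

theorem theorem3p10:
  fixes T\<^sub>1 \<beta> :: real
    and L1 L2 :: "(real \<Rightarrow> real^'m) set \<Rightarrow> real"
  assumes "0 < T\<^sub>1" and "0 < \<beta>"
  shows "\<exists>(LK :: (real \<times> (real \<Rightarrow> real^'m)) set \<Rightarrow> real)
          (CK :: (real \<times> (real \<Rightarrow> real^'m)) set \<Rightarrow> (real \<Rightarrow> real^'d) \<Rightarrow> real).
    (\<forall>K. 0 < LK K) \<and> (\<forall>K x. 0 < CK K x) \<and>
    (\<forall>(T\<^sub>0 :: real) (\<alpha> :: real) (x :: real \<Rightarrow> real^'d)
       (f1 :: real \<times> (real \<Rightarrow> real^'m) \<Rightarrow> (real^'d) \<Rightarrow>\<^sub>L (real^'m))
       (f2 :: real \<times> (real \<Rightarrow> real^'m) \<Rightarrow> (real^'d) \<Rightarrow>\<^sub>L (real^'m))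
       w1 w2 y1 y2.
       0 \<le> T\<^sub>0 \<and> T\<^sub>0 < T\<^sub>1 \<and> 1/2 < \<alpha> \<and> \<alpha> < 1 \<and> \<beta> < \<alpha> \<and>
       x \<in> holder_paths 1 T\<^sub>1 \<and>
       continuous_map (stopped_topology \<alpha> \<beta> T\<^sub>1) euclidean f1 \<and>
       continuous_map (stopped_topology \<alpha> \<beta> T\<^sub>1) euclidean f2 \<and>
       lipschitz_on_compacts \<alpha> \<beta> T\<^sub>1 f1 L1 \<and>
       lipschitz_on_compacts \<alpha> \<beta> T\<^sub>1 f2 L2 \<and>
       linear_growth \<alpha> \<beta> T\<^sub>1 f1 \<and>
       linear_growth \<alpha> \<beta> T\<^sub>1 f2 \<and>
       (T\<^sub>0, stop T\<^sub>1 T\<^sub>0 w1) \<in> stopped_paths \<alpha> T\<^sub>1 \<and>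
       (T\<^sub>0, stop T\<^sub>1 T\<^sub>0 w2) \<in> stopped_paths \<alpha> T\<^sub>1 \<and>
       is_solution \<alpha> T\<^sub>0 T\<^sub>1 x f1 w1 y1 \<and>
       is_solution \<alpha> T\<^sub>0 T\<^sub>1 x f2 w2 y2
       \<longrightarrow>
       (\<exists>K. compactin (prod_topology (top_of_set {0..T\<^sub>1}) (holder_topology \<alpha> \<beta> T\<^sub>1)) K \<and>
            (\<forall>t\<in>{T\<^sub>0..T\<^sub>1}. (t, y1) \<in> K \<and> (t, y2) \<in> K) \<and>
            holder_seminorm \<beta> 0 T\<^sub>1 (\<lambda>t. y1 t - y2 t) \<le>
              CK K x * (norm (w1 0 - w2 0) + holder_seminorm \<beta> 0 T\<^sub>0 (\<lambda>t. w1 t - w2 t) +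
                        (SUP p\<in>stop_image T\<^sub>1 K. norm (f1 p - f2 p))) \<and>
            ((\<forall>t\<in>{0..T\<^sub>0}. w1 t = w2 t) \<longrightarrow>
              holder_seminorm \<beta> T\<^sub>0 T\<^sub>1 (\<lambda>t. y1 t - y2 t) \<le>
                2 ^ nat \<lceil>T\<^sub>1 * (2 * LK K * holder_seminorm 1 0 T\<^sub>1 x) powr (1 / (1 - \<beta>))\<rceil>
                * (1 + 1 / LK K) * (SUP p\<in>stop_image T\<^sub>1 K. norm (f1 p - f2 p)))))"
proof -
  define LK :: "(real \<times> (real \<Rightarrow> real^'m)) set \<Rightarrow> real" where
    "LK K = (if 0 < L1 (snd ` K) then L1 (snd ` K) else 1)" for K
  define CK :: "(real \<times> (real \<Rightarrow> real^'m)) set \<Rightarrow> (real \<Rightarrow> real^'d) \<Rightarrow> real" where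
    "CK K x = 2 ^ nat \<lceil>T\<^sub>1 * (2 * LK K * holder_seminorm 1 0 T\<^sub>1 x) powr (1 / (1 - \<beta>))\<rceil> * (1 + 1 / LK K)"
    for K x
  have LK: "0 < LK K" for K
    by (simp add: LK_def)
  then have CK: "0 < CK K x" for K x
    by (simp add: CK_def add_pos_pos)
  show ?thesis
  proof (intro exI[of _ LK] exI[of _ CK] conjI allI impI; (elim conjE)?)
    fix T\<^sub>0 \<alpha> :: real and x :: "real \<Rightarrow> real^'d"
      and f1 f2 :: "real \<times> (real \<Rightarrow> real^'m) \<Rightarrow> (real^'d) \<Rightarrow>\<^sub>L (real^'m)"
      and w1 w2 y1 y2 :: "real \<Rightarrow> real^'m"
    assume par: "0 \<le> T\<^sub>0" "T\<^sub>0 < T\<^sub>1" "1/2 < \<alpha>" "\<alpha> < 1" "\<beta> < \<alpha>"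
      and x: "x \<in> holder_paths 1 T\<^sub>1"
      and lip: "lipschitz_on_compacts \<alpha> \<beta> T\<^sub>1 f1 L1"
      and growth: "linear_growth \<alpha> \<beta> T\<^sub>1 f1" "linear_growth \<alpha> \<beta> T\<^sub>1 f2"
      and sol: "is_solution \<alpha> T\<^sub>0 T\<^sub>1 x f1 w1 y1" "is_solution \<alpha> T\<^sub>0 T\<^sub>1 x f2 w2 y2"
    \<comment> \<open>All times from 0 on are included because
      \<open>solution_difference_bound\<close> compares the functionals along \<open>y2\<close> on
      the whole of \<open>{0..T\<^sub>1}\<close>. The path component is finite, hence
      compact.\<close>
    define K where "K = {0..T\<^sub>1} \<times> {y1, y2}"
    define \<epsilon> where "\<epsilon> = (SUP p\<in>stop_image T\<^sub>1 K. norm (f1 p - f2 p))"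
    have paths: "y1 \<in> holder_paths \<alpha> T\<^sub>1" "y2 \<in> holder_paths \<alpha> T\<^sub>1"
      using sol by (auto simp: is_solution_def)
    have compact: "compactin (holder_topology \<alpha> \<beta> T\<^sub>1) {y1, y2}"
      using paths assms par Metric_space.topspace_mtopology[OF Metric_space_holder[of T\<^sub>1 \<beta> \<alpha>, where 'a="real^'m"]]
      by (intro finite_imp_compactin) (auto simp: holder_topology_def)
    have "snd ` K = {y1, y2}"
      using assms by (simp add: K_def)
    \<comment> \<open>The projection of \<open>K\<close> is compact, so \<open>L1\<close> is
      positive there and the default does not occur.\<close>
    then have "LK K = L1 {y1, y2}"
      using lip compact by (simp add: LK_def lipschitz_on_compacts_def)
    then have lip': "norm (f1 (t, stop T\<^sub>1 t y1) - f1 (t, stop T\<^sub>1 t y2)) \<le>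
        LK K * (norm (y1 0 - y2 0) + holder_seminorm \<beta> 0 T\<^sub>1 (\<lambda>s. stop T\<^sub>1 t y1 s - stop T\<^sub>1 t y2 s))"
      if "t \<in> {0..T\<^sub>1}" for t
      using lip compact that by (simp add: lipschitz_on_compacts_def)
    \<comment> \<open>A real supremum is an upper bound only of a set that is bounded above; linear
      growth of both functionals provides this along each solution.\<close>
    have bounded: "\<exists>B. \<forall>t\<in>{0..T\<^sub>1}. norm (f1 (t, stop T\<^sub>1 t y) - f2 (t, stop T\<^sub>1 t y)) \<le> B"
      if y: "y \<in> holder_paths \<alpha> T\<^sub>1" for y
    proof -
      obtain B B' where "\<forall>t\<in>{0..T\<^sub>1}. norm (f1 (t, stop T\<^sub>1 t y)) \<le> B"
          "\<forall>t\<in>{0..T\<^sub>1}. norm (f2 (t, stop T\<^sub>1 t y)) \<le> B'"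
        using growth[THEN linear_growth_stopped_bounded] y assms par by (metis less_imp_le)
      then show ?thesis
        by (intro exI[of _ "B + B'"] ballI order_trans[OF norm_triangle_ineq4] add_mono) auto
    qed
    obtain B1 B2 where
      "\<And>t. t \<in> {0..T\<^sub>1} \<Longrightarrow> norm (f1 (t, stop T\<^sub>1 t y1) - f2 (t, stop T\<^sub>1 t y1)) \<le> B1"
      "\<And>t. t \<in> {0..T\<^sub>1} \<Longrightarrow> norm (f1 (t, stop T\<^sub>1 t y2) - f2 (t, stop T\<^sub>1 t y2)) \<le> B2"
      using bounded[OF paths(1)] bounded[OF paths(2)] by blast
    then have bdd: "bdd_above ((\<lambda>p. norm (f1 p - f2 p)) ` stop_image T\<^sub>1 K)"
      by (intro bdd_aboveI[of _ "max B1 B2"]) (auto simp: stop_image_def K_def le_max_iff_disj)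
    have near: "norm (f1 (t, stop T\<^sub>1 t y2) - f2 (t, stop T\<^sub>1 t y2)) \<le> \<epsilon>" if "t \<in> {0..T\<^sub>1}" for t
      unfolding \<epsilon>_def by (rule cSUP_upper[OF _ bdd]) (use that in \<open>force simp: stop_image_def K_def\<close>)
    have "0 \<le> \<epsilon>"
      using order_trans[OF norm_ge_zero near[of 0]] assms by simp
    have main: "holder_seminorm \<beta> 0 T\<^sub>1 (\<lambda>t. y1 t - y2 t) \<le>
        CK K x * (norm (w1 0 - w2 0) + holder_seminorm \<beta> 0 T\<^sub>0 (\<lambda>t. w1 t - w2 t) + \<epsilon>)"
      unfolding CK_def using assms par x LK \<open>0 \<le> \<epsilon>\<close> lip' near
      by (intro solution_difference_bound[OF sol]) auto
    show "\<exists>K. compactin (prod_topology (top_of_set {0..T\<^sub>1}) (holder_topology \<alpha> \<beta> T\<^sub>1)) K \<and>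
            (\<forall>t\<in>{T\<^sub>0..T\<^sub>1}. (t, y1) \<in> K \<and> (t, y2) \<in> K) \<and>
            holder_seminorm \<beta> 0 T\<^sub>1 (\<lambda>t. y1 t - y2 t) \<le>
              CK K x * (norm (w1 0 - w2 0) + holder_seminorm \<beta> 0 T\<^sub>0 (\<lambda>t. w1 t - w2 t) +
                        (SUP p\<in>stop_image T\<^sub>1 K. norm (f1 p - f2 p))) \<and>
            ((\<forall>t\<in>{0..T\<^sub>0}. w1 t = w2 t) \<longrightarrow>
              holder_seminorm \<beta> T\<^sub>0 T\<^sub>1 (\<lambda>t. y1 t - y2 t) \<le>
                2 ^ nat \<lceil>T\<^sub>1 * (2 * LK K * holder_seminorm 1 0 T\<^sub>1 x) powr (1 / (1 - \<beta>))\<rceil>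
                * (1 + 1 / LK K) * (SUP p\<in>stop_image T\<^sub>1 K. norm (f1 p - f2 p)))"
    proof (intro exI[of _ K] conjI impI)
      show "compactin (prod_topology (top_of_set {0..T\<^sub>1}) (holder_topology \<alpha> \<beta> T\<^sub>1)) K"
        unfolding K_def using compact by (simp add: compactin_Times compactin_subtopology)
      show "\<forall>t\<in>{T\<^sub>0..T\<^sub>1}. (t, y1) \<in> K \<and> (t, y2) \<in> K"
        using par by (auto simp: K_def)
    next
      show "holder_seminorm \<beta> 0 T\<^sub>1 (\<lambda>t. y1 t - y2 t) \<le> CK K x *
          (norm (w1 0 - w2 0) + holder_seminorm \<beta> 0 T\<^sub>0 (\<lambda>t. w1 t - w2 t) +
            (SUP p\<in>stop_image T\<^sub>1 K. norm (f1 p - f2 p)))"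
        using main by (simp add: \<epsilon>_def)
    next
      assume eq: "\<forall>t\<in>{0..T\<^sub>0}. w1 t = w2 t"
      \<comment> \<open>For equal initial paths only \<open>\<epsilon>\<close> remains in
        \<open>main\<close>. Since \<open>CK\<close> was defined as the explicit factor, restricting
        the seminorm to the later interval finishes the second estimate.\<close>
      have "holder_seminorm \<beta> 0 T\<^sub>0 (\<lambda>t. w1 t - w2 t) \<le> 0"
        using eq by (intro holder_seminorm_le) auto
      then have "norm (w1 0 - w2 0) + holder_seminorm \<beta> 0 T\<^sub>0 (\<lambda>t. w1 t - w2 t) + \<epsilon> = \<epsilon>"
        using eq par holder_seminorm_nonneg[of \<beta> 0 T\<^sub>0 "\<lambda>t. w1 t - w2 t"] by simp
      then have "holder_seminorm \<beta> 0 T\<^sub>1 (\<lambda>t. y1 t - y2 t) \<le> CK K x * \<epsilon>"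
        using main by simp
      moreover have "holder_seminorm \<beta> T\<^sub>0 T\<^sub>1 (\<lambda>t. y1 t - y2 t)
          \<le> holder_seminorm \<beta> 0 T\<^sub>1 (\<lambda>t. y1 t - y2 t)"
        using par holder_quotients_bounded[OF _ paths, of \<beta>] by (intro holder_seminorm_subinterval) auto
      ultimately show "holder_seminorm \<beta> T\<^sub>0 T\<^sub>1 (\<lambda>t. y1 t - y2 t) \<le>
          2 ^ nat \<lceil>T\<^sub>1 * (2 * LK K * holder_seminorm 1 0 T\<^sub>1 x) powr (1 / (1 - \<beta>))\<rceil> *
          (1 + 1 / LK K) * (SUP p\<in>stop_image T\<^sub>1 K. norm (f1 p - f2 p))"
        by (simp add: \<epsilon>_def CK_def)
    qed
  qed (use LK CK in auto)
qed

end
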